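(* For non-commuting indeterminates $x,y$ let $u=\tfrac12(x+y)$, $v=\tfrac12(x-y)$, $\pi(x,y)=(u,v^2,vuv)$ and $p_n=x^n+y^n$. For every positive integer $n$ there exists a rational function $P_n$ in three non-commuting variables $\alpha,\beta,\gamma$ such that $p_n=P_n\circ\pi$, i.e. $x^n+y^n=P_n(u,v^2,vuv)$. Moreover $P_n(\alpha,\beta,\gamma)$ can be expressed as a free polynomial in $\alpha,\beta,\gamma$ and $\beta^{-1}$. The functions $P_n$ can be calculated from the equation $$\begin{pmatrix}p_n\\ q_n\end{pmatrix}=\begin{bmatrix}u&v\\ v&u\end{bmatrix}^n\begin{pmatrix}2\\0\end{pmatrix},\qquad q_n=x^n-y^n,$$ or recursively from the relations $P_0(\alpha,\beta,\gamma)=2$, $Q_0(\alpha,\beta,\gamma)=0$ and, for $n\ge0$, $$P_{n+1}=\alpha P_n+Q_n,\qquad Q_{n+1}=\beta P_n+\gamma\beta^{-1}Q_n .$$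
   Context: A free polynomial is a polynomial over $\mathbb{C}$ in non-commuting variables. A non-commutative rational expression is one built from non-commuting variables by sums, products, scalar multiples and inverses; it is nondegenerate if it can be evaluated at some tuple of square complex matrices of some common size, and a non-commutative rational function is an equivalence class of nondegenerate expressions that agree wherever both are defined on matrix tuples. The identity $p_n=P_n\circ\pi$ is understood as an identity of non-commutative rational functions in $x,y$; it is valid whenever $x,y$ are square complex matrices of the same size with $x-y$ nonsingular. *)

theory Defs
  imports
    "Jordan_Normal_Form.Gauss_Jordan_Elimination"
    "Jordan_Normal_Form.Determinant"
    "HOL-Library.Poly_Mapping"
    "HOL-Library.Monad_Syntax"
begin

section \<open>Non-commutative rational expressions\<close>

datatype 'v ncexpr =
    Const complex
  | Var 'v
  | Add "'v ncexpr" "'v ncexpr"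
  | Smult complex "'v ncexpr"
  | Mult "'v ncexpr" "'v ncexpr"
  | Inv "'v ncexpr"

definition mat_tuple :: "nat \<Rightarrow> ('v \<Rightarrow> complex mat) \<Rightarrow> bool" where
  "mat_tuple k X \<longleftrightarrow> 0 < k \<and> (\<forall>v. X v \<in> carrier_mat k k)"

text \<open>The result is \<open>None\<close> exactly if a singular matrix has to be inverted.\<close>

primrec nc_eval :: "nat \<Rightarrow> ('v \<Rightarrow> complex mat) \<Rightarrow> 'v ncexpr \<Rightarrow> complex mat option" where
  "nc_eval k X (Const c) = Some (c \<cdot>\<^sub>m 1\<^sub>m k)"
| "nc_eval k X (Var v) = Some (X v)"
| "nc_eval k X (Add e f) = do {A \<leftarrow> nc_eval k X e; B \<leftarrow> nc_eval k X f; Some (A + B)}"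
| "nc_eval k X (Smult c e) = do {A \<leftarrow> nc_eval k X e; Some (c \<cdot>\<^sub>m A)}"
| "nc_eval k X (Mult e f) = do {A \<leftarrow> nc_eval k X e; B \<leftarrow> nc_eval k X f; Some (A * B)}"
| "nc_eval k X (Inv e) = do {A \<leftarrow> nc_eval k X e; mat_inverse A}"

primrec nc_subst :: "('v \<Rightarrow> 'w ncexpr) \<Rightarrow> 'v ncexpr \<Rightarrow> 'w ncexpr" where
  "nc_subst g (Const c) = Const c"
| "nc_subst g (Var v) = g v"
| "nc_subst g (Add e f) = Add (nc_subst g e) (nc_subst g f)"
| "nc_subst g (Smult c e) = Smult c (nc_subst g e)"
| "nc_subst g (Mult e f) = Mult (nc_subst g e) (nc_subst g f)"
| "nc_subst g (Inv e) = Inv (nc_subst g e)"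

text \<open>Size \<open>0\<close> is excluded by \<^const>\<open>mat_tuple\<close>: every expression is defined on
  \<open>0 \<times> 0\<close> matrices.\<close>

definition nondegenerate :: "'v ncexpr \<Rightarrow> bool" where
  "nondegenerate e \<longleftrightarrow> (\<exists>k X. mat_tuple k X \<and> nc_eval k X e \<noteq> None)"

definition nc_equiv :: "'v ncexpr \<Rightarrow> 'v ncexpr \<Rightarrow> bool" where
  "nc_equiv e f \<longleftrightarrow> nondegenerate e \<and> nondegenerate f \<and>
     (\<forall>k X A B. mat_tuple k X \<longrightarrow> nc_eval k X e = Some A \<longrightarrow> nc_eval k X f = Some B \<longrightarrow> A = B)"


section \<open>Transitivity of the equivalence\<close>

text \<open>Two nondegenerate expressions need not be defined at a common size, let alone at a
  common point. After passing to direct sums of copies of the given points, the two sizes agree,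
  and along the line through two points the value of an expression is a rational function of the
  line parameter.\<close>

lemma mat_inverse_SomeI:
  fixes A B :: "complex mat"
  assumes A: "A \<in> carrier_mat n n" and B: "B \<in> carrier_mat n n"
    and AB: "A * B = 1\<^sub>m n" and BA: "B * A = 1\<^sub>m n"
  shows "mat_inverse A = Some B"
proof -
  have "A \<in> Units (ring_mat TYPE(complex) n ())"
    using assms unfolding Units_def ring_mat_def by auto
  with mat_inverse(1)[OF A, of "()"] obtain C where C: "mat_inverse A = Some C"
    by (cases "mat_inverse A") auto
  from mat_inverse(2)[OF A C] have CA: "C * A = 1\<^sub>m n" and Cc: "C \<in> carrier_mat n n" by auto
  have "C = C * (A * B)" using AB Cc by simp
  also have "\<dots> = (C * A) * B" using A B Cc by simp
  also have "\<dots> = B" using CA B by simp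
  finally show ?thesis using C by simp
qed

lemma nc_eval_carrier:
  assumes "\<And>v. X v \<in> carrier_mat k k"
  shows "nc_eval k X e = Some A \<Longrightarrow> A \<in> carrier_mat k k"
proof (induction e arbitrary: A)
  case (Inv e)
  then obtain B where "nc_eval k X e = Some B" "mat_inverse B = Some A"
    by (auto split: bind_splits)
  with Inv.IH mat_inverse(2) show ?case by blast
qed (use assms in \<open>auto split: bind_splits\<close>)

definition dsum :: "nat \<Rightarrow> nat \<Rightarrow> complex mat \<Rightarrow> complex mat \<Rightarrow> complex mat" where
  "dsum k l A B = four_block_mat A (0\<^sub>m k l) (0\<^sub>m l k) B"

lemma dsum_carrier [simp]:
  "A \<in> carrier_mat k k \<Longrightarrow> B \<in> carrier_mat l l \<Longrightarrow> dsum k l A B \<in> carrier_mat (k + l) (k + l)"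
  by (auto simp: dsum_def)

lemma dsum_mult:
  assumes "A \<in> carrier_mat k k" "B \<in> carrier_mat l l" "C \<in> carrier_mat k k" "D \<in> carrier_mat l l"
  shows "dsum k l A B * dsum k l C D = dsum k l (A * C) (B * D)"
  unfolding dsum_def using assms
  by (subst mult_four_block_mat[of _ k k _ l _ l _ _ k _ l]) auto

lemma dsum_add:
  assumes "A \<in> carrier_mat k k" "B \<in> carrier_mat l l" "C \<in> carrier_mat k k" "D \<in> carrier_mat l l"
  shows "dsum k l A B + dsum k l C D = dsum k l (A + C) (B + D)"
  unfolding dsum_def using assms
  by (subst add_four_block_mat[of _ k k _ l _ l]) auto

lemma dsum_smult:
  assumes "A \<in> carrier_mat k k" "B \<in> carrier_mat l l"
  shows "c \<cdot>\<^sub>m dsum k l A B = dsum k l (c \<cdot>\<^sub>m A) (c \<cdot>\<^sub>m B)"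
  unfolding dsum_def using assms
  by (subst smult_four_block_mat[of _ k k _ l _ l]) auto

lemma dsum_one: "dsum k l (1\<^sub>m k) (1\<^sub>m l) = 1\<^sub>m (k + l)"
  by (simp add: dsum_def)

lemma nc_eval_dsum:
  assumes X: "\<And>v. X v \<in> carrier_mat k k" and Y: "\<And>v. Y v \<in> carrier_mat l l"
  shows "nc_eval k X e = Some A \<Longrightarrow> nc_eval l Y e = Some B \<Longrightarrow>
    nc_eval (k + l) (\<lambda>v. dsum k l (X v) (Y v)) e = Some (dsum k l A B)"
proof (induction e arbitrary: A B)
  case (Const c)
  then show ?case by (auto simp: dsum_smult dsum_one[symmetric])
next
  case (Var v)
  then show ?case by auto
next
  case (Add e f)
  then obtain A1 A2 B1 B2 where
    *: "nc_eval k X e = Some A1" "nc_eval k X f = Some A2" "A = A1 + A2"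
      "nc_eval l Y e = Some B1" "nc_eval l Y f = Some B2" "B = B1 + B2"
    by (auto split: bind_splits)
  with nc_eval_carrier[of X, OF X] nc_eval_carrier[of Y, OF Y]
  show ?case by (simp add: Add.IH dsum_add)
next
  case (Smult c e)
  then obtain A1 B1 where
    *: "nc_eval k X e = Some A1" "A = c \<cdot>\<^sub>m A1" "nc_eval l Y e = Some B1" "B = c \<cdot>\<^sub>m B1"
    by (auto split: bind_splits)
  with nc_eval_carrier[of X, OF X] nc_eval_carrier[of Y, OF Y]
  show ?case by (simp add: Smult.IH dsum_smult)
next
  case (Mult e f)
  then obtain A1 A2 B1 B2 where
    *: "nc_eval k X e = Some A1" "nc_eval k X f = Some A2" "A = A1 * A2"
      "nc_eval l Y e = Some B1" "nc_eval l Y f = Some B2" "B = B1 * B2"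
    by (auto split: bind_splits)
  with nc_eval_carrier[of X, OF X] nc_eval_carrier[of Y, OF Y]
  show ?case by (simp add: Mult.IH dsum_mult)
next
  case (Inv e)
  then obtain A1 B1 where
    *: "nc_eval k X e = Some A1" "mat_inverse A1 = Some A"
      "nc_eval l Y e = Some B1" "mat_inverse B1 = Some B"
    by (auto split: bind_splits)
  have A1: "A1 \<in> carrier_mat k k" and B1: "B1 \<in> carrier_mat l l"
    using nc_eval_carrier[of X, OF X] nc_eval_carrier[of Y, OF Y] * by auto
  note iA = mat_inverse(2)[OF A1 *(2)] and iB = mat_inverse(2)[OF B1 *(4)]
  have "mat_inverse (dsum k l A1 B1) = Some (dsum k l A B)"
    by (rule mat_inverse_SomeI[of _ "k + l"]) (use A1 B1 iA iB in \<open>simp_all add: dsum_mult dsum_one\<close>)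
  with * show ?case by (simp add: Inv.IH)
qed

lemma nc_eval_copies:
  assumes X: "\<And>v. X v \<in> carrier_mat k k"
  shows "\<exists>Z. (\<forall>v. Z v \<in> carrier_mat (Suc m * k) (Suc m * k)) \<and>
    (\<forall>e A. nc_eval k X e = Some A \<longrightarrow> (\<exists>B. nc_eval (Suc m * k) Z e = Some B \<and>
       (\<forall>i<k. \<forall>j<k. B $$ (i, j) = A $$ (i, j))))"
proof (induction m)
  case 0
  have eq: "Suc 0 * k = k" by simp
  show ?case unfolding eq using X by blast
next
  case (Suc m)
  from Suc.IH obtain Z where Z': "\<forall>v. Z v \<in> carrier_mat (Suc m * k) (Suc m * k)"
    and ev: "\<forall>e A. nc_eval k X e = Some A \<longrightarrow> (\<exists>B. nc_eval (Suc m * k) Z e = Some B \<and>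
       (\<forall>i<k. \<forall>j<k. B $$ (i, j) = A $$ (i, j)))"
    by (elim exE conjE) (rule that; assumption)
  have Z: "Z v \<in> carrier_mat (Suc m * k) (Suc m * k)" for v using Z' by blast
  let ?Z = "\<lambda>v. dsum k (Suc m * k) (X v) (Z v)"
  have eq: "Suc (Suc m) * k = k + Suc m * k" by simp
  have "\<exists>B. nc_eval (k + Suc m * k) ?Z e = Some B \<and> (\<forall>i<k. \<forall>j<k. B $$ (i, j) = A $$ (i, j))"
    if A: "nc_eval k X e = Some A" for e A
  proof -
    from ev[rule_format, OF A] obtain B where B: "nc_eval (Suc m * k) Z e = Some B" by blast
    have "A \<in> carrier_mat k k" using nc_eval_carrier[of X, OF X A] .
    moreover have "B \<in> carrier_mat (Suc m * k) (Suc m * k)" using nc_eval_carrier[of Z, OF Z B] .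
    ultimately have "\<forall>i<k. \<forall>j<k. dsum k (Suc m * k) A B $$ (i, j) = A $$ (i, j)"
      by (auto simp: dsum_def)
    with nc_eval_dsum[of X k Z, OF X Z A B] show ?thesis by blast
  qed
  moreover have "?Z v \<in> carrier_mat (k + Suc m * k) (k + Suc m * k)" for v
    using X Z by (intro dsum_carrier)
  ultimately show ?case unfolding eq by (intro exI[of _ ?Z] conjI allI impI)
qed

abbreviation at_param :: "complex \<Rightarrow> complex poly mat \<Rightarrow> complex mat" where
  "at_param t \<equiv> map_mat (\<lambda>p. poly p t)"

lemma at_param_mult:
  "A \<in> carrier_mat n n \<Longrightarrow> B \<in> carrier_mat n n \<Longrightarrow> at_param t (A * B) = at_param t A * at_param t B"
  by (rule semiring_hom.mat_hom_mult[where hom = "\<lambda>p. poly p t"]) (unfold_locales, auto)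

lemma at_param_add:
  "A \<in> carrier_mat n n \<Longrightarrow> B \<in> carrier_mat n n \<Longrightarrow> at_param t (A + B) = at_param t A + at_param t B"
  by (rule eq_matI) auto

lemma at_param_smult: "at_param t (p \<cdot>\<^sub>m A) = poly p t \<cdot>\<^sub>m at_param t A"
  by (rule eq_matI) auto

lemma smult_smult_mat: "a \<cdot>\<^sub>m (b \<cdot>\<^sub>m A) = (a * b :: complex) \<cdot>\<^sub>m A"
  by (rule eq_matI) auto

lemma at_param_one: "at_param t (1\<^sub>m n) = 1\<^sub>m n"
  by (rule eq_matI) auto

lemma at_param_det: "det (at_param t A) = poly (det A) t"
  by (rule comm_ring_hom.hom_det[where hom = "\<lambda>p. poly p t"]) (unfold_locales, auto)

lemma nc_eval_line:
  fixes W :: "'v \<Rightarrow> complex poly mat"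
  assumes W: "\<And>v. W v \<in> carrier_mat n n"
  shows "nc_eval n (\<lambda>v. at_param s (W v)) e \<noteq> None \<Longrightarrow>
    \<exists>d M. M \<in> carrier_mat n n \<and> poly d s \<noteq> 0 \<and>
      (\<forall>t. poly d t \<noteq> 0 \<longrightarrow>
         nc_eval n (\<lambda>v. at_param t (W v)) e = Some (inverse (poly d t) \<cdot>\<^sub>m at_param t M))"
proof (induction e)
  case (Const c)
  show ?case
    by (rule exI[of _ 1], rule exI[of _ "[:c:] \<cdot>\<^sub>m 1\<^sub>m n"])
      (auto simp: at_param_smult at_param_one)
next
  case (Var v)
  show ?case
    by (rule exI[of _ 1], rule exI[of _ "W v"]) (use W in auto)
next
  case (Add e f)
  from Add.prems have "nc_eval n (\<lambda>v. at_param s (W v)) e \<noteq> None"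
    "nc_eval n (\<lambda>v. at_param s (W v)) f \<noteq> None" by (auto split: bind_splits)
  with Add.IH obtain d M d' M' where
    *: "M \<in> carrier_mat n n" "M' \<in> carrier_mat n n" "poly d s \<noteq> 0" "poly d' s \<noteq> 0"
    and ev: "\<And>t. poly d t \<noteq> 0 \<Longrightarrow>
      nc_eval n (\<lambda>v. at_param t (W v)) e = Some (inverse (poly d t) \<cdot>\<^sub>m at_param t M)"
      "\<And>t. poly d' t \<noteq> 0 \<Longrightarrow>
      nc_eval n (\<lambda>v. at_param t (W v)) f = Some (inverse (poly d' t) \<cdot>\<^sub>m at_param t M')"
    by metis
  have "inverse (poly d t) \<cdot>\<^sub>m at_param t M + inverse (poly d' t) \<cdot>\<^sub>m at_param t M' =
      inverse (poly (d * d') t) \<cdot>\<^sub>m at_param t (d' \<cdot>\<^sub>m M + d \<cdot>\<^sub>m M')"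
    if "poly (d * d') t \<noteq> 0" for t
    by (rule eq_matI) (use * that in \<open>auto simp: field_simps\<close>)
  with * ev show ?case
    by (intro exI[of _ "d * d'"] exI[of _ "d' \<cdot>\<^sub>m M + d \<cdot>\<^sub>m M'"]) auto
next
  case (Smult c e)
  from Smult.prems have "nc_eval n (\<lambda>v. at_param s (W v)) e \<noteq> None"
    by (auto split: bind_splits)
  with Smult.IH obtain d M where
    *: "M \<in> carrier_mat n n" "poly d s \<noteq> 0"
    and ev: "\<And>t. poly d t \<noteq> 0 \<Longrightarrow>
      nc_eval n (\<lambda>v. at_param t (W v)) e = Some (inverse (poly d t) \<cdot>\<^sub>m at_param t M)"
    by metis
  have "c \<cdot>\<^sub>m (inverse (poly d t) \<cdot>\<^sub>m at_param t M) =
      inverse (poly d t) \<cdot>\<^sub>m at_param t ([:c:] \<cdot>\<^sub>m M)" for t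
    by (rule eq_matI) auto
  with * ev show ?case
    by (intro exI[of _ d] exI[of _ "[:c:] \<cdot>\<^sub>m M"]) auto
next
  case (Mult e f)
  from Mult.prems have "nc_eval n (\<lambda>v. at_param s (W v)) e \<noteq> None"
    "nc_eval n (\<lambda>v. at_param s (W v)) f \<noteq> None" by (auto split: bind_splits)
  with Mult.IH obtain d M d' M' where
    *: "M \<in> carrier_mat n n" "M' \<in> carrier_mat n n" "poly d s \<noteq> 0" "poly d' s \<noteq> 0"
    and ev: "\<And>t. poly d t \<noteq> 0 \<Longrightarrow>
      nc_eval n (\<lambda>v. at_param t (W v)) e = Some (inverse (poly d t) \<cdot>\<^sub>m at_param t M)"
      "\<And>t. poly d' t \<noteq> 0 \<Longrightarrow>
      nc_eval n (\<lambda>v. at_param t (W v)) f = Some (inverse (poly d' t) \<cdot>\<^sub>m at_param t M')"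
    by metis
  have "(inverse (poly d t) \<cdot>\<^sub>m at_param t M) * (inverse (poly d' t) \<cdot>\<^sub>m at_param t M') =
      inverse (poly (d * d') t) \<cdot>\<^sub>m at_param t (M * M')" for t
    using * by (simp add: at_param_mult mult_smult_assoc_mat[of _ n n _ n]
        mult_smult_distrib[of _ n n _ n] smult_smult_mat ac_simps)
  with * ev show ?case
    by (intro exI[of _ "d * d'"] exI[of _ "M * M'"]) auto
next
  case (Inv e)
  from Inv.prems obtain C D where
    C: "nc_eval n (\<lambda>v. at_param s (W v)) e = Some C" and D: "mat_inverse C = Some D"
    by (auto split: bind_splits)
  with Inv.IH obtain d M where
    *: "M \<in> carrier_mat n n" "poly d s \<noteq> 0"
    and ev: "\<And>t. poly d t \<noteq> 0 \<Longrightarrow>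
      nc_eval n (\<lambda>v. at_param t (W v)) e = Some (inverse (poly d t) \<cdot>\<^sub>m at_param t M)"
    by (metis option.distinct(1))
  have Ceq: "C = inverse (poly d s) \<cdot>\<^sub>m at_param s M" using ev[OF *(2)] C by simp
  have Cc: "C \<in> carrier_mat n n" using * Ceq by simp
  from mat_inverse(2)[OF Cc D] have CD: "C * D = 1\<^sub>m n" "D \<in> carrier_mat n n" by auto
  have "det C * det D = 1" using det_mult[OF Cc CD(2)] CD by simp
  hence "det C \<noteq> 0" by auto
  hence dM: "poly (det M) s \<noteq> 0"
    unfolding Ceq det_smult at_param_det by simp
  have inv: "mat_inverse (inverse (poly d t) \<cdot>\<^sub>m at_param t M) =
      Some (inverse (poly (d * det M) t) \<cdot>\<^sub>m at_param t ((d * d) \<cdot>\<^sub>m adj_mat M))"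
    if t: "poly (d * det M) t \<noteq> 0" for t
  proof (rule mat_inverse_SomeI[of _ n])
    note adj = adj_mat[OF *(1)]
    have t': "poly d t \<noteq> 0" "poly (det M) t \<noteq> 0" using t by auto
    have 1: "at_param t M * at_param t (adj_mat M) = poly (det M) t \<cdot>\<^sub>m 1\<^sub>m n"
      "at_param t (adj_mat M) * at_param t M = poly (det M) t \<cdot>\<^sub>m 1\<^sub>m n"
      using adj * by (simp_all flip: at_param_mult add: at_param_smult at_param_one)
    show "inverse (poly d t) \<cdot>\<^sub>m at_param t M \<in> carrier_mat n n"
      "inverse (poly (d * det M) t) \<cdot>\<^sub>m at_param t ((d * d) \<cdot>\<^sub>m adj_mat M) \<in> carrier_mat n n"
      using adj * by auto
    show "(inverse (poly d t) \<cdot>\<^sub>m at_param t M) *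
        (inverse (poly (d * det M) t) \<cdot>\<^sub>m at_param t ((d * d) \<cdot>\<^sub>m adj_mat M)) = 1\<^sub>m n"
      using adj * t' apply (simp add: at_param_smult mult_smult_assoc_mat[of _ n n _ n]
        mult_smult_distrib[of _ n n _ n] smult_smult_mat 1)
      by (rule eq_matI, auto simp: field_simps)
    show "(inverse (poly (d * det M) t) \<cdot>\<^sub>m at_param t ((d * d) \<cdot>\<^sub>m adj_mat M)) *
        (inverse (poly d t) \<cdot>\<^sub>m at_param t M) = 1\<^sub>m n"
      using adj * t' apply (simp add: at_param_smult mult_smult_assoc_mat[of _ n n _ n]
        mult_smult_distrib[of _ n n _ n] smult_smult_mat 1)
      by (rule eq_matI, auto simp: field_simps)
  qed
  show ?case
    by (intro exI[of _ "d * det M"] exI[of _ "(d * d) \<cdot>\<^sub>m adj_mat M"])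
      (use * dM adj_mat[OF *(1)] in \<open>auto simp: ev inv[simplified]\<close>)
qed

lemma common_line:
  fixes f :: "'v ncexpr"
  assumes X: "mat_tuple k X" and f: "nondegenerate f"
  shows "\<exists>n W d. k \<le> n \<and> (\<forall>v. W v \<in> carrier_mat n n) \<and> d \<noteq> 0 \<and>
     (\<forall>t. poly d t \<noteq> 0 \<longrightarrow> nc_eval n (\<lambda>v. at_param t (W v)) f \<noteq> None) \<and>
     (\<forall>e A. nc_eval k X e = Some A \<longrightarrow>
       (\<exists>B. nc_eval n (\<lambda>v. at_param 0 (W v)) e = Some B \<and>
         (\<forall>i<k. \<forall>j<k. B $$ (i, j) = A $$ (i, j))))"
proof -
  from f obtain l Y where Y: "mat_tuple l Y" and fY: "nc_eval l Y f \<noteq> None"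
    by (auto simp: nondegenerate_def)
  obtain m where m: "l = Suc m" using Y by (cases l) (auto simp: mat_tuple_def)
  obtain m' where m': "k = Suc m'" using X by (cases k) (auto simp: mat_tuple_def)
  define n where "n = k * l"
  have n1: "Suc m * k = n" and n2: "Suc m' * l = n" by (simp_all add: n_def m m')
  have "k \<le> n" by (simp add: n_def m)
  from nc_eval_copies[of X k m] X obtain Z where Z: "\<And>v. Z v \<in> carrier_mat n n"
    and evZ: "\<And>e A. nc_eval k X e = Some A \<Longrightarrow>
      \<exists>B. nc_eval n Z e = Some B \<and> (\<forall>i<k. \<forall>j<k. B $$ (i, j) = A $$ (i, j))"
    unfolding n1 mat_tuple_def by blast
  from nc_eval_copies[of Y l m'] Y obtain V where V: "\<And>v. V v \<in> carrier_mat n n"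
    and evV: "\<And>e A. nc_eval l Y e = Some A \<Longrightarrow>
      \<exists>B. nc_eval n V e = Some B \<and> (\<forall>i<l. \<forall>j<l. B $$ (i, j) = A $$ (i, j))"
    unfolding n2 mat_tuple_def by blast
  define W where "W v = mat n n (\<lambda>ij. [:Z v $$ ij, V v $$ ij - Z v $$ ij:])" for v
  have W: "\<And>v. W v \<in> carrier_mat n n" by (simp add: W_def)
  have W0: "at_param 0 (W v) = Z v" for v
    by (rule eq_matI) (use Z[of v] in \<open>auto simp: W_def\<close>)
  have W1: "at_param 1 (W v) = V v" for v
    by (rule eq_matI) (use V[of v] in \<open>auto simp: W_def\<close>)
  have "nc_eval n (\<lambda>v. at_param 1 (W v)) f \<noteq> None"
    using fY evV unfolding W1 by (metis not_Some_eq)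
  from nc_eval_line[of W, OF W this] obtain d M where d: "poly d 1 \<noteq> 0"
    "\<And>t. poly d t \<noteq> 0 \<Longrightarrow>
       nc_eval n (\<lambda>v. at_param t (W v)) f = Some (inverse (poly d t) \<cdot>\<^sub>m at_param t M)" by blast
  show ?thesis
  proof (rule exI[of _ n], rule exI[of _ W], rule exI[of _ d], intro conjI allI impI)
    show "k \<le> n" by fact
    show "W v \<in> carrier_mat n n" for v by (fact W)
    show "d \<noteq> 0" using d(1) by auto
    show "nc_eval n (\<lambda>v. at_param t (W v)) f \<noteq> None" if "poly d t \<noteq> 0" for t
      using d(2)[OF that] by simp
    show "\<exists>B. nc_eval n (\<lambda>v. at_param 0 (W v)) e = Some B \<and> (\<forall>i<k. \<forall>j<k. B $$ (i, j) = A $$ (i, j))"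
      if "nc_eval k X e = Some A" for e A using evZ[OF that] unfolding W0 .
  qed
qed

lemma common_point:
  assumes "nondegenerate e" "nondegenerate f"
  shows "\<exists>k X. mat_tuple k X \<and> nc_eval k X e \<noteq> None \<and> nc_eval k X f \<noteq> None"
proof -
  from assms obtain k X A where X: "mat_tuple k X" and A: "nc_eval k X e = Some A"
    by (auto simp: nondegenerate_def)
  from common_line[OF X assms(2)] obtain n W d where
    n: "k \<le> n" and W': "\<forall>v. W v \<in> carrier_mat n n" and d: "d \<noteq> 0"
    and f: "\<forall>t. poly d t \<noteq> 0 \<longrightarrow> nc_eval n (\<lambda>v. at_param t (W v)) f \<noteq> None"
    and ev0: "\<forall>e A. nc_eval k X e = Some A \<longrightarrow>
       (\<exists>B. nc_eval n (\<lambda>v. at_param 0 (W v)) e = Some B \<and>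
         (\<forall>i<k. \<forall>j<k. B $$ (i, j) = A $$ (i, j)))"
    by (elim exE conjE) (rule that; assumption)
  have W: "W v \<in> carrier_mat n n" for v using W' by blast
  have e: "nc_eval n (\<lambda>v. at_param 0 (W v)) e \<noteq> None"
    using ev0[rule_format, OF A] by auto
  from nc_eval_line[of W, OF W e] obtain d' M where d': "poly d' 0 \<noteq> 0"
    "\<And>t. poly d' t \<noteq> 0 \<Longrightarrow>
       nc_eval n (\<lambda>v. at_param t (W v)) e = Some (inverse (poly d' t) \<cdot>\<^sub>m at_param t M)" by blast
  have "d * d' \<noteq> 0" using d d' by auto
  then obtain t where "poly (d * d') t \<noteq> 0" using poly_all_0_iff_0 by blast
  hence "nc_eval n (\<lambda>v. at_param t (W v)) e \<noteq> None" "nc_eval n (\<lambda>v. at_param t (W v)) f \<noteq> None"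
    using d' f by auto
  moreover have "mat_tuple n (\<lambda>v. at_param t (W v))"
    using X W n by (auto simp: mat_tuple_def)
  ultimately show ?thesis by blast
qed

lemma nc_equivD:
  "nc_equiv e f \<Longrightarrow> mat_tuple k X \<Longrightarrow> nc_eval k X e = Some A \<Longrightarrow> nc_eval k X f = Some B \<Longrightarrow> A = B"
  unfolding nc_equiv_def by blast

lemma nc_equiv_nondegenerate: "nc_equiv e f \<Longrightarrow> nondegenerate e \<and> nondegenerate f"
  unfolding nc_equiv_def by blast

lemma nc_equiv_trans:
  assumes ef: "nc_equiv e f" and fg: "nc_equiv f g"
  shows "nc_equiv e g"
proof -
  have "A = B" if X: "mat_tuple k X" and A: "nc_eval k X e = Some A" and B: "nc_eval k X g = Some B"
    for k X A B
  proof -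
    have f: "nondegenerate f" using nc_equiv_nondegenerate[OF ef] by simp
    from common_line[OF X f] obtain n W d where
      n: "k \<le> n" and W': "\<forall>v. W v \<in> carrier_mat n n" and d: "d \<noteq> 0"
      and evf: "\<forall>t. poly d t \<noteq> 0 \<longrightarrow> nc_eval n (\<lambda>v. at_param t (W v)) f \<noteq> None"
      and ev0: "\<forall>e A. nc_eval k X e = Some A \<longrightarrow>
       (\<exists>B. nc_eval n (\<lambda>v. at_param 0 (W v)) e = Some B \<and>
         (\<forall>i<k. \<forall>j<k. B $$ (i, j) = A $$ (i, j)))"
      by (elim exE conjE) (rule that; assumption)
    have W: "W v \<in> carrier_mat n n" for v using W' by blast
    from ev0[rule_format, OF A] obtain A' where A': "nc_eval n (\<lambda>v. at_param 0 (W v)) e = Some A'"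
      "\<And>i j. i < k \<Longrightarrow> j < k \<Longrightarrow> A' $$ (i, j) = A $$ (i, j)" by blast
    from ev0[rule_format, OF B] obtain B' where B': "nc_eval n (\<lambda>v. at_param 0 (W v)) g = Some B'"
      "\<And>i j. i < k \<Longrightarrow> j < k \<Longrightarrow> B' $$ (i, j) = B $$ (i, j)" by blast
    have "nc_eval n (\<lambda>v. at_param 0 (W v)) e \<noteq> None" using A'(1) by simp
    from nc_eval_line[of W, OF W this] obtain p M where p: "M \<in> carrier_mat n n" "poly p 0 \<noteq> 0"
      "\<And>t. poly p t \<noteq> 0 \<Longrightarrow>
        nc_eval n (\<lambda>v. at_param t (W v)) e = Some (inverse (poly p t) \<cdot>\<^sub>m at_param t M)" by blast
    have "nc_eval n (\<lambda>v. at_param 0 (W v)) g \<noteq> None" using B'(1) by simp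
    from nc_eval_line[of W, OF W this] obtain q N where q: "N \<in> carrier_mat n n" "poly q 0 \<noteq> 0"
      "\<And>t. poly q t \<noteq> 0 \<Longrightarrow>
        nc_eval n (\<lambda>v. at_param t (W v)) g = Some (inverse (poly q t) \<cdot>\<^sub>m at_param t N)" by blast
    have eq: "A' $$ (i, j) = B' $$ (i, j)" if ij: "i < n" "j < n" for i j
    proof -
      define r where "r = q * M $$ (i, j) - p * N $$ (i, j)"
      have "poly (d * p * q * r) t = 0" for t
      proof (cases "poly (d * p * q) t = 0")
        case False
        hence t: "poly d t \<noteq> 0" "poly p t \<noteq> 0" "poly q t \<noteq> 0" by auto
        from evf[rule_format, OF t(1)] obtain F where F: "nc_eval n (\<lambda>v. at_param t (W v)) f = Some F" by blast
        have "mat_tuple n (\<lambda>v. at_param t (W v))"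
          using X W n by (auto simp: mat_tuple_def)
        hence "inverse (poly p t) \<cdot>\<^sub>m at_param t M = F" "F = inverse (poly q t) \<cdot>\<^sub>m at_param t N"
          using nc_equivD[OF ef _ p(3)[OF t(2)] F] nc_equivD[OF fg _ F q(3)[OF t(3)]] by auto
        hence "(inverse (poly p t) \<cdot>\<^sub>m at_param t M) $$ (i, j) =
            (inverse (poly q t) \<cdot>\<^sub>m at_param t N) $$ (i, j)" by simp
        thus ?thesis using ij p(1) q(1) t by (auto simp: r_def field_simps)
      qed auto
      hence "d * p * q * r = 0" using poly_all_0_iff_0 by blast
      moreover have "p \<noteq> 0" "q \<noteq> 0" using p(2) q(2) by auto
      ultimately have "r = 0" using d by simp
      hence "poly r 0 = 0" by simp
      moreover have "A' = inverse (poly p 0) \<cdot>\<^sub>m at_param 0 M" "B' = inverse (poly q 0) \<cdot>\<^sub>m at_param 0 N"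
        using A' B' p q by auto
      ultimately show ?thesis using ij p(1,2) q(1,2) by (auto simp: r_def field_simps)
    qed
    have "A \<in> carrier_mat k k" "B \<in> carrier_mat k k"
      using nc_eval_carrier[of X k] X A B by (auto simp: mat_tuple_def)
    moreover have "A $$ (i, j) = B $$ (i, j)" if "i < k" "j < k" for i j
      using A'(2)[OF that] B'(2)[OF that] eq[of i j] that n by simp
    ultimately show "A = B" by (intro eq_matI) auto
  qed
  moreover have "nondegenerate e" "nondegenerate g"
    using nc_equiv_nondegenerate[OF ef] nc_equiv_nondegenerate[OF fg] by simp_all
  ultimately show ?thesis unfolding nc_equiv_def by blast
qed


section \<open>Non-commutative rational functions\<close>

lemma nc_equivI:
  assumes "nondegenerate e" "nondegenerate f"
    "\<And>k X A B. mat_tuple k X \<Longrightarrow> nc_eval k X e = Some A \<Longrightarrow> nc_eval k X f = Some B \<Longrightarrow> A = B"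
  shows "nc_equiv e f"
  using assms unfolding nc_equiv_def by blast

lemma nondegenerate_Const [simp]: "nondegenerate (Const c)"
  unfolding nondegenerate_def
  by (intro exI[of _ 1] exI[of _ "\<lambda>_. 1\<^sub>m 1"]) (auto simp: mat_tuple_def)

lemma nondegenerate_Var [simp]: "nondegenerate (Var v)"
  unfolding nondegenerate_def
  by (intro exI[of _ 1] exI[of _ "\<lambda>_. 1\<^sub>m 1"]) (auto simp: mat_tuple_def)

lemma nondegenerate_Inv_Var [simp]: "nondegenerate (Inv (Var v))"
  unfolding nondegenerate_def
  by (intro exI[of _ 1] exI[of _ "\<lambda>_. 1\<^sub>m 1"])
    (auto simp: mat_tuple_def mat_inverse_SomeI[of "1\<^sub>m (Suc 0)" "Suc 0" "1\<^sub>m (Suc 0)"])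

lemma nondegenerate_Smult [simp]: "nondegenerate e \<Longrightarrow> nondegenerate (Smult c e)"
  unfolding nondegenerate_def by fastforce

lemma nondegenerate_Add [simp]: "nondegenerate e \<Longrightarrow> nondegenerate f \<Longrightarrow> nondegenerate (Add e f)"
  using common_point[of e f] unfolding nondegenerate_def by fastforce

lemma nondegenerate_Mult [simp]: "nondegenerate e \<Longrightarrow> nondegenerate f \<Longrightarrow> nondegenerate (Mult e f)"
  using common_point[of e f] unfolding nondegenerate_def by fastforce

lemma nc_equiv_refl: "nondegenerate e \<Longrightarrow> nc_equiv e e"
  by (rule nc_equivI) auto

lemma nc_equiv_sym: "nc_equiv e f \<Longrightarrow> nc_equiv f e"
  unfolding nc_equiv_def by blast

quotient_type 'v ncrat = "'v ncexpr" / partial: nc_equiv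
proof (rule part_equivpI)
  show "\<exists>e :: 'v ncexpr. nc_equiv e e"
    using nc_equiv_refl[OF nondegenerate_Const] by blast
  show "symp (nc_equiv :: 'v ncexpr \<Rightarrow> _)"
    by (rule sympI) (rule nc_equiv_sym)
  show "transp (nc_equiv :: 'v ncexpr \<Rightarrow> _)"
    by (rule transpI) (rule nc_equiv_trans)
qed

lift_definition ncrat_const :: "complex \<Rightarrow> 'v ncrat" is Const
  by (simp add: nc_equiv_refl)

lift_definition ncrat_var :: "'v \<Rightarrow> 'v ncrat" is Var
  by (simp add: nc_equiv_refl)

lift_definition ncrat_var_inv :: "'v \<Rightarrow> 'v ncrat" is "\<lambda>v. Inv (Var v)"
  by (simp add: nc_equiv_refl)

lift_definition ncrat_scale :: "complex \<Rightarrow> 'v ncrat \<Rightarrow> 'v ncrat" is Smult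
proof -
  fix c and e f :: "'v ncexpr"
  assume "nc_equiv e f"
  with nc_equiv_nondegenerate[OF this] show "nc_equiv (Smult c e) (Smult c f)"
    by (intro nc_equivI) (auto split: bind_splits dest: nc_equivD)
qed

instantiation ncrat :: (type) "{zero, one, plus, times, uminus, minus}"
begin

lift_definition zero_ncrat :: "'a ncrat" is "Const 0"
  by (simp add: nc_equiv_refl)

lift_definition one_ncrat :: "'a ncrat" is "Const 1"
  by (simp add: nc_equiv_refl)

lift_definition plus_ncrat :: "'a ncrat \<Rightarrow> 'a ncrat \<Rightarrow> 'a ncrat" is Add
proof -
  fix e f e' f' :: "'a ncexpr"
  assume *: "nc_equiv e f" "nc_equiv e' f'"
  with nc_equiv_nondegenerate[OF *(1)] nc_equiv_nondegenerate[OF *(2)]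
  show "nc_equiv (Add e e') (Add f f')"
    by (intro nc_equivI) (auto split: bind_splits dest: nc_equivD)
qed

lift_definition times_ncrat :: "'a ncrat \<Rightarrow> 'a ncrat \<Rightarrow> 'a ncrat" is Mult
proof -
  fix e f e' f' :: "'a ncexpr"
  assume *: "nc_equiv e f" "nc_equiv e' f'"
  with nc_equiv_nondegenerate[OF *(1)] nc_equiv_nondegenerate[OF *(2)]
  show "nc_equiv (Mult e e') (Mult f f')"
    by (intro nc_equivI) (auto split: bind_splits dest: nc_equivD)
qed

definition uminus_ncrat :: "'a ncrat \<Rightarrow> 'a ncrat" where
  "uminus_ncrat F = ncrat_scale (- 1) F"

definition minus_ncrat :: "'a ncrat \<Rightarrow> 'a ncrat \<Rightarrow> 'a ncrat" where
  "minus_ncrat F G = F + (- G)"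

instance ..

end

lemma mat_tuple_eval_carrier:
  "nc_eval k X e = Some A \<Longrightarrow> mat_tuple k X \<Longrightarrow> A \<in> carrier_mat k k"
  by (rule nc_eval_carrier) (auto simp: mat_tuple_def)

lemma nc_equiv_self: "nc_equiv e e \<Longrightarrow> nondegenerate e"
  using nc_equiv_nondegenerate by blast

instance ncrat :: (type) ring_1
proof
  fix a b c :: "'a ncrat"
  show "a + b + c = a + (b + c)"
    by (transfer, rule nc_equivI)
      (auto split: bind_splits dest!: nc_equiv_self mat_tuple_eval_carrier
        simp: assoc_add_mat)
  show "a + b = b + a"
    by (transfer, rule nc_equivI)
      (auto split: bind_splits dest!: nc_equiv_self mat_tuple_eval_carrier
        simp: comm_add_mat)
  show "0 + a = a"
    by (transfer, rule nc_equivI)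
      (auto split: bind_splits dest!: nc_equiv_self mat_tuple_eval_carrier
        intro!: eq_matI)
  show "- a + a = 0"
    unfolding uminus_ncrat_def
    by (transfer, rule nc_equivI)
      (auto split: bind_splits dest!: nc_equiv_self mat_tuple_eval_carrier
        intro!: eq_matI)
  show "a - b = a + (- b)"
    by (simp add: minus_ncrat_def)
  show "a * b * c = a * (b * c)"
    by (transfer, rule nc_equivI)
      (auto split: bind_splits dest!: nc_equiv_self mat_tuple_eval_carrier
        simp: assoc_mult_mat)
  show "1 * a = a"
    by (transfer, rule nc_equivI)
      (auto split: bind_splits dest!: nc_equiv_self mat_tuple_eval_carrier
        simp: mult_smult_assoc_mat)
  show "a * 1 = a"
    by (transfer, rule nc_equivI)
      (auto split: bind_splits dest!: nc_equiv_self mat_tuple_eval_carrier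
        simp: mult_smult_distrib)
  show "(a + b) * c = a * c + b * c"
    by (transfer, rule nc_equivI)
      (auto split: bind_splits dest!: nc_equiv_self mat_tuple_eval_carrier
        simp: add_mult_distrib_mat)
  show "a * (b + c) = a * b + a * c"
    by (transfer, rule nc_equivI)
      (auto split: bind_splits dest!: nc_equiv_self mat_tuple_eval_carrier
        simp: mult_add_distrib_mat)
  show "(0 :: 'a ncrat) \<noteq> 1"
  proof (transfer, rule notI)
    assume eq: "nc_equiv (Const 0 :: 'a ncexpr) (Const 1)"
    have "mat_tuple 1 (\<lambda>_ :: 'a. 1\<^sub>m 1)" by (simp add: mat_tuple_def)
    from nc_equivD[OF eq this] have "0 \<cdot>\<^sub>m 1\<^sub>m 1 = (1 \<cdot>\<^sub>m 1\<^sub>m 1 :: complex mat)" by simp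
    hence "(0 \<cdot>\<^sub>m 1\<^sub>m 1 :: complex mat) $$ (0, 0) = (1 \<cdot>\<^sub>m 1\<^sub>m 1) $$ (0, 0)" by simp
    thus False by simp
  qed
qed

definition represents :: "'v ncexpr \<Rightarrow> 'v ncrat \<Rightarrow> bool" where
  "represents e F \<longleftrightarrow> nondegenerate e \<and> F = abs_ncrat e"

text \<open>\<open>F\<close> is defined at the matrix tuple \<open>X\<close>, with value \<open>A\<close>. Any representative of \<open>F\<close> may be
  used for the evaluation.\<close>

definition ncrat_value :: "nat \<Rightarrow> ('v \<Rightarrow> complex mat) \<Rightarrow> 'v ncrat \<Rightarrow> complex mat \<Rightarrow> bool" where
  "ncrat_value k X F A \<longleftrightarrow> mat_tuple k X \<and> (\<exists>e. represents e F \<and> nc_eval k X e = Some A)"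

text \<open>\<open>H = F \<circ> G\<close>, where \<open>G\<close> lists the rational functions that are substituted for the variables
  of \<open>F\<close>. Substitution can yield a degenerate expression, which represents no rational function;
  this is why composition is a relation.\<close>

definition is_ncrat_comp :: "'v ncrat \<Rightarrow> ('v \<Rightarrow> 'w ncrat) \<Rightarrow> 'w ncrat \<Rightarrow> bool" where
  "is_ncrat_comp F G H \<longleftrightarrow>
     (\<exists>e g. represents e F \<and> (\<forall>v. represents (g v) (G v)) \<and> represents (nc_subst g e) H)"

text \<open>A free polynomial is a finite linear combination of words.\<close>

type_synonym 'a fpoly = "'a list \<Rightarrow>\<^sub>0 complex"

definition fpoly_subst :: "('a \<Rightarrow> 'v ncrat) \<Rightarrow> 'a fpoly \<Rightarrow> 'v ncrat" where
  "fpoly_subst g f =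
     (\<Sum>w\<in>Poly_Mapping.keys f. ncrat_scale (Poly_Mapping.lookup f w) (prod_list (map g w)))"


section \<open>Sums of powers of two variables\<close>

datatype var_xy = Var_x | Var_y

definition x_fun :: "var_xy ncrat" where "x_fun = ncrat_var Var_x"
definition y_fun :: "var_xy ncrat" where "y_fun = ncrat_var Var_y"
definition u_fun :: "var_xy ncrat" where "u_fun = ncrat_scale (1/2) (x_fun + y_fun)"
definition v_fun :: "var_xy ncrat" where "v_fun = ncrat_scale (1/2) (x_fun - y_fun)"
definition p_fun :: "nat \<Rightarrow> var_xy ncrat" where "p_fun n = x_fun ^ n + y_fun ^ n"
definition q_fun :: "nat \<Rightarrow> var_xy ncrat" where "q_fun n = x_fun ^ n - y_fun ^ n"

definition uv_matrix :: "var_xy ncrat mat" where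
  "uv_matrix = mat_of_rows_list 2 [[u_fun, v_fun], [v_fun, u_fun]]"

datatype var_abc = Var_alpha | Var_beta | Var_gamma

definition alpha_fun :: "var_abc ncrat" where "alpha_fun = ncrat_var Var_alpha"
definition beta_fun :: "var_abc ncrat" where "beta_fun = ncrat_var Var_beta"
definition gamma_fun :: "var_abc ncrat" where "gamma_fun = ncrat_var Var_gamma"
definition beta_inv_fun :: "var_abc ncrat" where "beta_inv_fun = ncrat_var_inv Var_beta"

primrec pi_fun :: "var_abc \<Rightarrow> var_xy ncrat" where
  "pi_fun Var_alpha = u_fun"
| "pi_fun Var_beta = v_fun ^ 2"
| "pi_fun Var_gamma = v_fun * u_fun * v_fun"

primrec pi_mat :: "complex mat \<Rightarrow> complex mat \<Rightarrow> var_abc \<Rightarrow> complex mat" where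
  "pi_mat X Y Var_alpha = (1/2) \<cdot>\<^sub>m (X + Y)"
| "pi_mat X Y Var_beta = ((1/2) \<cdot>\<^sub>m (X - Y)) ^\<^sub>m 2"
| "pi_mat X Y Var_gamma =
     ((1/2) \<cdot>\<^sub>m (X - Y)) * ((1/2) \<cdot>\<^sub>m (X + Y)) * ((1/2) \<cdot>\<^sub>m (X - Y))"

datatype letter = L_alpha | L_beta | L_gamma | L_beta_inv

primrec letter_fun :: "letter \<Rightarrow> var_abc ncrat" where
  "letter_fun L_alpha = alpha_fun"
| "letter_fun L_beta = beta_fun"
| "letter_fun L_gamma = gamma_fun"
| "letter_fun L_beta_inv = beta_inv_fun"

end

theory Submission
  imports Defs
begin

text \<open>With \<open>x = u + v\<close> and \<open>y = u - v\<close> one has \<open>p\<^sub>n\<^sub>+\<^sub>1 = u p\<^sub>n + v q\<^sub>n\<close> and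
  \<open>q\<^sub>n\<^sub>+\<^sub>1 = v p\<^sub>n + u q\<^sub>n\<close>. The recursion for \<open>P\<^sub>n\<close> and \<open>Q\<^sub>n\<close> is the one satisfied by \<open>p\<^sub>n\<close> and
  \<open>v q\<^sub>n\<close>, since \<open>v u q\<^sub>n = (v u v) v\<^sup>-\<^sup>2 (v q\<^sub>n)\<close>.\<close>

section \<open>Scalar multiples and representatives\<close>

lemma abs_ncrat_Add:
  "nondegenerate e \<Longrightarrow> nondegenerate f \<Longrightarrow> abs_ncrat (Add e f) = abs_ncrat e + abs_ncrat f"
  by (simp add: plus_ncrat.abs_eq eq_onp_def nc_equiv_refl)

lemma abs_ncrat_Mult:
  "nondegenerate e \<Longrightarrow> nondegenerate f \<Longrightarrow> abs_ncrat (Mult e f) = abs_ncrat e * abs_ncrat f"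
  by (simp add: times_ncrat.abs_eq eq_onp_def nc_equiv_refl)

lemma abs_ncrat_Smult:
  "nondegenerate e \<Longrightarrow> abs_ncrat (Smult c e) = ncrat_scale c (abs_ncrat e)"
  by (simp add: ncrat_scale.abs_eq eq_onp_def nc_equiv_refl)

lemma abs_ncrat_eq: "nc_equiv e f \<Longrightarrow> abs_ncrat e = abs_ncrat f"
  using Quotient_rel_abs[OF Quotient_ncrat] .

lemma represents_Var: "represents (Var v) (ncrat_var v)"
  by (simp add: represents_def ncrat_var.abs_eq)

lemma represents_Add: "represents e F \<Longrightarrow> represents f G \<Longrightarrow> represents (Add e f) (F + G)"
  by (simp add: represents_def abs_ncrat_Add)

lemma represents_Mult: "represents e F \<Longrightarrow> represents f G \<Longrightarrow> represents (Mult e f) (F * G)"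
  by (simp add: represents_def abs_ncrat_Mult)

lemma represents_Smult: "represents e F \<Longrightarrow> represents (Smult c e) (ncrat_scale c F)"
  by (simp add: represents_def abs_ncrat_Smult)

text \<open>Expressions have no subtraction, so a difference is a sum with a
  \<open>(- 1)\<close>-multiple, in the same way as \<open>-\<close> is defined on
  \<open>ncrat\<close>.\<close>

lemma represents_minus:
  "represents e F \<Longrightarrow> represents f G \<Longrightarrow> represents (Add e (Smult (- 1) f)) (F - G)"
  by (simp add: diff_conv_add_uminus uminus_ncrat_def represents_Add represents_Smult
      del: add_uminus_conv_diff)

lemma ncrat_scale_add: "ncrat_scale c (F + G) = ncrat_scale c F + ncrat_scale c G"
  by (transfer, rule nc_equivI)
    (auto split: bind_splits dest!: nc_equiv_self mat_tuple_eval_carrier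
      intro!: eq_matI simp: algebra_simps)

lemma ncrat_scale_add_scalar: "ncrat_scale (c + d) F = ncrat_scale c F + ncrat_scale d F"
  by (transfer, rule nc_equivI)
    (auto split: bind_splits dest!: nc_equiv_self mat_tuple_eval_carrier
      intro!: eq_matI simp: algebra_simps)

lemma ncrat_scale_one [simp]: "ncrat_scale 1 F = F"
  by (transfer, rule nc_equivI)
    (auto split: bind_splits dest!: nc_equiv_self mat_tuple_eval_carrier intro!: eq_matI)

lemma ncrat_scale_zero [simp]: "ncrat_scale 0 F = 0"
  using ncrat_scale_add_scalar[of 0 0 F] by simp

lemma ncrat_scale_mult_right: "F * ncrat_scale c G = ncrat_scale c (F * G)"
  by (transfer, rule nc_equivI)
    (auto split: bind_splits dest!: nc_equiv_self mat_tuple_eval_carrier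
      simp: mult_smult_distrib)

lemma ncrat_const_eq_scale: "ncrat_const c = ncrat_scale c 1"
  by (transfer, rule nc_equivI) auto

lemma ncrat_const_2: "ncrat_const 2 = 2"
  using ncrat_scale_add_scalar[of 1 1 1] by (simp add: ncrat_const_eq_scale)

lemma ncrat_const_0: "ncrat_const 0 = 0"
  by (simp add: ncrat_const_eq_scale)

section \<open>Free polynomials\<close>

text \<open>Words outside the support have coefficient \<open>0\<close> and contribute nothing. A
  larger index set lets sums over different supports be combined.\<close>

lemma fpoly_subst_superset:
  assumes "finite S" "Poly_Mapping.keys f \<subseteq> S"
  shows "fpoly_subst g f =
    (\<Sum>w\<in>S. ncrat_scale (Poly_Mapping.lookup f w) (prod_list (map g w)))"
  unfolding fpoly_subst_def
  by (rule sum.mono_neutral_left) (use assms in \<open>auto simp: in_keys_iff\<close>)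

lemma fpoly_subst_add: "fpoly_subst g (f + h) = fpoly_subst g f + fpoly_subst g h"
proof -
  let ?S = "Poly_Mapping.keys f \<union> Poly_Mapping.keys h"
  show ?thesis
    by (simp add: fpoly_subst_superset[of ?S] Poly_Mapping.keys_add lookup_add
        ncrat_scale_add_scalar sum.distrib)
qed

lemma fpoly_subst_single:
  "fpoly_subst g (Poly_Mapping.single w c) = ncrat_scale c (prod_list (map g w))"
  by (simp add: fpoly_subst_superset[of "{w}"])

text \<open>Lying in \<open>range (fpoly_subst g)\<close> means being a free polynomial in the
  values of \<open>g\<close>. Closure properties of this set take the place of explicit
  coefficients.\<close>

lemma range_fpoly_subst_0: "0 \<in> range (fpoly_subst g)"
  by (rule range_eqI[of _ _ 0]) (simp add: fpoly_subst_def)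

lemma range_fpoly_subst_add:
  "F \<in> range (fpoly_subst g) \<Longrightarrow> G \<in> range (fpoly_subst g) \<Longrightarrow> F + G \<in> range (fpoly_subst g)"
  by (auto simp: fpoly_subst_add[symmetric])

lemma range_fpoly_subst_sum:
  "(\<And>w. w \<in> S \<Longrightarrow> F w \<in> range (fpoly_subst g)) \<Longrightarrow> sum F S \<in> range (fpoly_subst g)"
  by (induction S rule: infinite_finite_induct)
    (simp_all add: range_fpoly_subst_0 range_fpoly_subst_add)

lemma range_fpoly_subst_const: "ncrat_scale c 1 \<in> range (fpoly_subst g)"
  using fpoly_subst_single[of g "[]" c] by (metis list.simps(8) prod_list.Nil rangeI)

text \<open>Left multiplication by a letter prepends it to every word and keeps the coefficients,
  because scalars pass through products.\<close>

lemma range_fpoly_subst_letter_mult: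
  assumes "F \<in> range (fpoly_subst g)"
  shows "g a * F \<in> range (fpoly_subst g)"
proof -
  obtain f where "F = fpoly_subst g f" using assms by blast
  hence "g a * F = (\<Sum>w\<in>Poly_Mapping.keys f.
      fpoly_subst g (Poly_Mapping.single (a # w) (Poly_Mapping.lookup f w)))"
    by (simp add: fpoly_subst_single fpoly_subst_def[of g f] sum_distrib_left
        ncrat_scale_mult_right)
  thus ?thesis by (simp add: range_fpoly_subst_sum)
qed

section \<open>Square matrices\<close>

text \<open>The matrix power puts its new factor on the right, whereas the recurrences multiply from
  the left.\<close>

lemma pow_mat_Suc_left:
  assumes "A \<in> carrier_mat n n"
  shows "A ^\<^sub>m Suc m = A * A ^\<^sub>m m"
proof (induction m)
  case (Suc m)
  have "A ^\<^sub>m Suc (Suc m) = (A * A ^\<^sub>m m) * A" using Suc by simp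
  also have "\<dots> = A * (A ^\<^sub>m m * A)"
    using assms by (simp add: assoc_mult_mat[of _ n n _ n _ n])
  finally show ?case by simp
qed (use assms in simp)

text \<open>With \<open>A\<close> and \<open>B\<close> the n-th powers of \<open>U + V\<close> and
  \<open>U - V\<close>, the right-hand sides are the next sum and difference of powers.\<close>

lemma sum_diff_mult_mat:
  fixes U V A B :: "complex mat"
  assumes "U \<in> carrier_mat k k" "V \<in> carrier_mat k k" "A \<in> carrier_mat k k" "B \<in> carrier_mat k k"
  shows "U * (A + B) + V * (A - B) = (U + V) * A + (U - V) * B"
    and "V * (A + B) + U * (A - B) = (U + V) * A - (U - V) * B"
proof -
  have *: "U * (A + B) = U * A + U * B" "V * (A + B) = V * A + V * B"
    "U * (A - B) = U * A - U * B" "V * (A - B) = V * A - V * B"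
    "(U + V) * A = U * A + V * A" "(U - V) * B = U * B - V * B"
    using assms by (simp_all add: mult_add_distrib_mat[of _ k k _ k]
        mult_minus_distrib_mat[of _ k k _ k]
        add_mult_distrib_mat[of _ k k _ _ k] minus_mult_distrib_mat[of _ k k _ _ k])
  show "U * (A + B) + V * (A - B) = (U + V) * A + (U - V) * B"
    unfolding * by (rule eq_matI) (use assms in \<open>auto simp del: index_mult_mat(1)\<close>)
  show "V * (A + B) + U * (A - B) = (U + V) * A - (U - V) * B"
    unfolding * by (rule eq_matI) (use assms in \<open>auto simp del: index_mult_mat(1)\<close>)
qed

text \<open>The inverse \<open>W\<close> of \<open>V * V\<close> commutes with \<open>V\<close>, so
  \<open>V W V = V V W = 1\<close>. This is the cancellation of the inverse of beta in the
  recursion.\<close>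

lemma conj_inverse_square:
  fixes V W :: "complex mat"
  assumes V: "V \<in> carrier_mat k k" and W: "W \<in> carrier_mat k k"
    and inv: "(V * V) * W = 1\<^sub>m k" "W * (V * V) = 1\<^sub>m k"
  shows "V * (W * V) = 1\<^sub>m k"
proof -
  note [simp] = assoc_mult_mat[of _ k k _ k _ k]
  \<comment> \<open>The factor \<open>(V * V) * W = 1\<close> is appended so that regrouping exposes
    \<open>W * (V * V) = 1\<close>.\<close>
  have "W * V = (W * V) * ((V * V) * W)" using inv V W by simp
  also have "\<dots> = (W * (V * V)) * (V * W)" using V W by simp
  also have "\<dots> = V * W" unfolding inv(2) using V W by simp
  finally have "V * (W * V) = (V * V) * W" using V W by simp
  thus ?thesis using inv by simp
qed

text \<open>If \<open>B\<close> inverts \<open>A\<close>, the square of \<open>inverse c\<close>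
  times \<open>B\<close> is the required inverse. For \<open>A = X - Y\<close> and
  \<open>c = 1/2\<close> the inverted matrix is the value of beta.\<close>

lemma mat_inverse_square:
  fixes A :: "complex mat"
  assumes A: "A \<in> carrier_mat k k" and "invertible_mat A" and c: "c \<noteq> 0"
  shows "mat_inverse ((c \<cdot>\<^sub>m A) ^\<^sub>m 2) \<noteq> None"
proof -
  from assms obtain B where AB: "A * B = 1\<^sub>m k" and BA: "B * A = 1\<^sub>m (dim_row B)"
    unfolding invertible_mat_def inverts_mat_def by auto
  \<comment> \<open>\<open>invertible_mat\<close> does not state the size of the inverse; comparing
    column counts in \<open>AB\<close> and \<open>BA\<close> yields it.\<close>
  have B: "B \<in> carrier_mat k k"
    using arg_cong[OF AB, of dim_col] arg_cong[OF BA, of dim_col] A by auto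
  let ?V = "c \<cdot>\<^sub>m A" and ?D = "inverse c \<cdot>\<^sub>m B"
  have V: "?V \<in> carrier_mat k k" and D: "?D \<in> carrier_mat k k" using A B by auto
  have VD: "?V * ?D = 1\<^sub>m k" and DV: "?D * ?V = 1\<^sub>m k"
    using A B AB BA c by (simp_all add: mult_smult_assoc_mat[of _ k k _ k]
        mult_smult_distrib[of _ k k _ k] smult_smult_mat) (auto intro!: eq_matI)
  have *: "(P * P) * (R * R) = 1\<^sub>m k"
    if P: "P \<in> carrier_mat k k" and R: "R \<in> carrier_mat k k" and PR: "P * R = 1\<^sub>m k"
    for P R :: "complex mat"
  proof -
    have "(P * P) * (R * R) = P * ((P * R) * R)"
      using P R by (simp add: assoc_mult_mat[of _ k k _ k _ k])
    thus ?thesis unfolding PR using P R PR by simp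
  qed
  have "mat_inverse (?V * ?V) = Some (?D * ?D)"
    by (rule mat_inverse_SomeI[of _ k]) (use V D VD DV * in auto)
  thus ?thesis using V by (simp add: numeral_2_eq_2)
qed

section \<open>The rational functions \<open>P\<^sub>n\<close> and \<open>Q\<^sub>n\<close>\<close>

text \<open>Concrete representatives are fixed because evaluation and substitution act on
  expressions, not on their classes.\<close>

fun P_expr :: "nat \<Rightarrow> var_abc ncexpr" and Q_expr :: "nat \<Rightarrow> var_abc ncexpr" where
  "P_expr 0 = Const 2"
| "Q_expr 0 = Const 0"
| "P_expr (Suc n) = Add (Mult (Var Var_alpha) (P_expr n)) (Q_expr n)"
| "Q_expr (Suc n) = Add (Mult (Var Var_beta) (P_expr n))
     (Mult (Mult (Var Var_gamma) (Inv (Var Var_beta))) (Q_expr n))"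

lemma nondegenerate_PQ_expr: "nondegenerate (P_expr n) \<and> nondegenerate (Q_expr n)"
  by (induction n) auto

definition P_fun :: "nat \<Rightarrow> var_abc ncrat" where "P_fun n = abs_ncrat (P_expr n)"
definition Q_fun :: "nat \<Rightarrow> var_abc ncrat" where "Q_fun n = abs_ncrat (Q_expr n)"

lemma represents_P_expr: "represents (P_expr n) (P_fun n)"
  by (simp add: represents_def P_fun_def nondegenerate_PQ_expr)

lemma PQ_fun_0: "P_fun 0 = 2" "Q_fun 0 = 0"
  by (simp_all add: P_fun_def Q_fun_def ncrat_const_2[symmetric] ncrat_const_0[symmetric]
      ncrat_const.abs_eq)

lemma PQ_fun_Suc:
  "P_fun (Suc n) = alpha_fun * P_fun n + Q_fun n"
  "Q_fun (Suc n) = beta_fun * P_fun n + gamma_fun * beta_inv_fun * Q_fun n"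
  by (simp_all add: P_fun_def Q_fun_def abs_ncrat_Add abs_ncrat_Mult nondegenerate_PQ_expr
      alpha_fun_def beta_fun_def gamma_fun_def beta_inv_fun_def ncrat_var.abs_eq
      ncrat_var_inv.abs_eq)

text \<open>Each recursion step multiplies by letters from the left; \<open>mult.assoc\<close>
  splits the coefficient of \<open>Q_fun n\<close>, gamma times the inverse of beta, into two such
  multiplications.\<close>

lemma PQ_fun_fpoly:
  "P_fun n \<in> range (fpoly_subst letter_fun) \<and> Q_fun n \<in> range (fpoly_subst letter_fun)"
proof (induction n)
  case 0
  then show ?case
    using range_fpoly_subst_const[of 2 letter_fun]
    by (simp add: PQ_fun_0 range_fpoly_subst_0 ncrat_const_eq_scale[symmetric] ncrat_const_2)
next
  case (Suc n)
  then show ?case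
    using range_fpoly_subst_letter_mult[of _ letter_fun L_alpha]
      range_fpoly_subst_letter_mult[of _ letter_fun L_beta]
      range_fpoly_subst_letter_mult[of _ letter_fun L_gamma]
      range_fpoly_subst_letter_mult[of _ letter_fun L_beta_inv]
    by (simp add: PQ_fun_Suc mult.assoc range_fpoly_subst_add)
qed

section \<open>Values of the expressions at matrix pairs\<close>

lemma pi_mat_carrier:
  "X \<in> carrier_mat k k \<Longrightarrow> Y \<in> carrier_mat k k \<Longrightarrow> pi_mat X Y w \<in> carrier_mat k k"
  by (cases w) (auto simp: numeral_2_eq_2)

text \<open>The second sequence takes the value \<open>v q_n\<close> rather than \<open>q_n\<close>,
  which makes its recursion expressible through \<open>v^2\<close> and \<open>vuv\<close>. Being
  conditional on definedness, the claim also covers points with singular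
  \<open>X - Y\<close>.\<close>

lemma PQ_expr_value:
  assumes X: "X \<in> carrier_mat k k" and Y: "Y \<in> carrier_mat k k"
  shows "(\<forall>A. nc_eval k (pi_mat X Y) (P_expr n) = Some A \<longrightarrow> A = X ^\<^sub>m n + Y ^\<^sub>m n) \<and>
    (\<forall>B. nc_eval k (pi_mat X Y) (Q_expr n) = Some B \<longrightarrow>
      B = ((1/2) \<cdot>\<^sub>m (X - Y)) * (X ^\<^sub>m n - Y ^\<^sub>m n))"
proof (induction n)
  case 0
  show ?case
    by (rule conjI; clarsimp; rule eq_matI) (use X Y in \<open>auto simp: scalar_prod_def\<close>)
next
  case (Suc n)
  define U where "U = (1/2) \<cdot>\<^sub>m (X + Y)"
  define V where "V = (1/2) \<cdot>\<^sub>m (X - Y)"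
  define p where "p = X ^\<^sub>m n + Y ^\<^sub>m n"
  define q where "q = X ^\<^sub>m n - Y ^\<^sub>m n"
  have Xn: "X ^\<^sub>m n \<in> carrier_mat k k" and Yn: "Y ^\<^sub>m n \<in> carrier_mat k k" using X Y by auto
  have c: "U \<in> carrier_mat k k" "V \<in> carrier_mat k k" "p \<in> carrier_mat k k" "q \<in> carrier_mat k k"
    using X Y Xn Yn by (auto simp: U_def V_def p_def q_def)
  have UV: "U + V = X" "U - V = Y"
    by (rule eq_matI; use X Y in \<open>auto simp: U_def V_def field_simps\<close>)+
  have p': "U * p + V * q = X ^\<^sub>m Suc n + Y ^\<^sub>m Suc n"
    and q': "V * p + U * q = X ^\<^sub>m Suc n - Y ^\<^sub>m Suc n"
    unfolding p_def q_def sum_diff_mult_mat[OF c(1,2) Xn Yn] UV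
      pow_mat_Suc_left[OF X] pow_mat_Suc_left[OF Y] by simp_all
  have beta: "V ^\<^sub>m 2 = V * V" using c by (simp add: numeral_2_eq_2)
  have P: "A = p" if "nc_eval k (pi_mat X Y) (P_expr n) = Some A" for A
    using Suc that by (simp add: p_def)
  have Q: "B = V * q" if "nc_eval k (pi_mat X Y) (Q_expr n) = Some B" for B
    using Suc that by (simp add: q_def V_def)
  \<comment> \<open>\<open>W\<close> is the value of the inverse of beta; it exists wherever
    \<open>Q_expr (Suc n)\<close> is defined.\<close>
  have "V * V * p + (V * U * V * W) * (V * q) = V * (X ^\<^sub>m Suc n - Y ^\<^sub>m Suc n)"
    if W: "mat_inverse (V * V) = Some W" for W
  proof -
    note [simp] = assoc_mult_mat[of _ k k _ k _ k]
    have VV: "V * V \<in> carrier_mat k k" using c by simp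
    from mat_inverse(2)[OF VV W] have Wc: "W \<in> carrier_mat k k"
      and inv: "(V * V) * W = 1\<^sub>m k" "W * (V * V) = 1\<^sub>m k" by auto
    \<comment> \<open>Regrouping isolates \<open>V W V\<close>, which is the identity.\<close>
    have "(V * U * V * W) * (V * q) = V * U * ((V * (W * V)) * q)" using c Wc by simp
    also have "\<dots> = V * (U * q)"
      unfolding conj_inverse_square[OF c(2) Wc inv] using c by simp
    finally have "V * V * p + (V * U * V * W) * (V * q) = V * (V * p) + V * (U * q)"
      using c by simp
    also have "\<dots> = V * (V * p + U * q)"
      using c by (simp add: mult_add_distrib_mat[of _ k k _ k])
    finally show ?thesis unfolding q' .
  qed
  note VW = this
  show ?case
  proof (intro conjI allI impI)
    fix A assume "nc_eval k (pi_mat X Y) (P_expr (Suc n)) = Some A"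
    then obtain A1 B1 where A1: "nc_eval k (pi_mat X Y) (P_expr n) = Some A1"
      and B1: "nc_eval k (pi_mat X Y) (Q_expr n) = Some B1" and A: "A = U * A1 + B1"
      by (auto simp: U_def split: bind_splits)
    show "A = X ^\<^sub>m Suc n + Y ^\<^sub>m Suc n"
      unfolding A P[OF A1] Q[OF B1] by (rule p')
  next
    fix B assume "nc_eval k (pi_mat X Y) (Q_expr (Suc n)) = Some B"
    then obtain A1 B1 W where A1: "nc_eval k (pi_mat X Y) (P_expr n) = Some A1"
      and B1: "nc_eval k (pi_mat X Y) (Q_expr n) = Some B1"
      and W: "mat_inverse (V ^\<^sub>m 2) = Some W"
      and B: "B = V ^\<^sub>m 2 * A1 + V * U * V * W * B1"
      unfolding U_def V_def by (auto split: bind_splits)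
    show "B = ((1/2) \<cdot>\<^sub>m (X - Y)) * (X ^\<^sub>m Suc n - Y ^\<^sub>m Suc n)"
      unfolding B P[OF A1] Q[OF B1] beta V_def[symmetric] by (rule VW[OF W[unfolded beta]])
  qed
qed

text \<open>\<open>Inv\<close> is only ever applied to the variable beta, so no other inversion can
  fail.\<close>

lemma PQ_expr_defined:
  assumes "mat_inverse (Z Var_beta) \<noteq> None"
  shows "nc_eval k Z (P_expr n) \<noteq> None \<and> nc_eval k Z (Q_expr n) \<noteq> None"
  using assms by (induction n) auto

text \<open>Nonsingular \<open>X - Y\<close> makes the value of beta invertible, hence the
  expression defined; \<open>PQ_expr_value\<close> then determines the value.\<close>

lemma P_expr_eval:
  assumes X: "X \<in> carrier_mat k k" and Y: "Y \<in> carrier_mat k k" and "invertible_mat (X - Y)"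
  shows "nc_eval k (pi_mat X Y) (P_expr n) = Some (X ^\<^sub>m n + Y ^\<^sub>m n)"
proof -
  have "mat_inverse (pi_mat X Y Var_beta) \<noteq> None"
    using mat_inverse_square[OF minus_carrier_mat[OF Y], of X "1/2"] assms by simp
  from PQ_expr_defined[of "pi_mat X Y", OF this] show ?thesis
    using PQ_expr_value[OF X Y, of n] by blast
qed

section \<open>Composition with \<open>\<pi>\<close>\<close>

lemma nc_eval_subst:
  "(\<And>v. nc_eval k X (g v) = Some (Z v)) \<Longrightarrow> nc_eval k X (nc_subst g e) = nc_eval k Z e"
  by (induction e) (auto)

section \<open>Expressions for powers and for the components of pi\<close>

primrec nc_pow :: "'v ncexpr \<Rightarrow> nat \<Rightarrow> 'v ncexpr" where
  "nc_pow e 0 = Const 1"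
| "nc_pow e (Suc n) = Mult (nc_pow e n) e"

lemma represents_nc_pow: "represents e F \<Longrightarrow> represents (nc_pow e n) (F ^ n)"
proof (induction n)
  case 0
  show ?case by (simp add: represents_def one_ncrat.abs_eq)
next
  case (Suc n)
  then show ?case by (simp add: represents_Mult power_Suc2 del: power_Suc)
qed

lemma nc_eval_nc_pow:
  "nc_eval k X e = Some A \<Longrightarrow> A \<in> carrier_mat k k \<Longrightarrow> nc_eval k X (nc_pow e n) = Some (A ^\<^sub>m n)"
  by (induction n) (auto intro!: eq_matI)

abbreviation "u_expr \<equiv> Smult (1/2) (Add (Var Var_x) (Var Var_y))"
abbreviation "v_expr \<equiv> Smult (1/2) (Add (Var Var_x) (Smult (- 1) (Var Var_y)))"

primrec pi_expr :: "var_abc \<Rightarrow> var_xy ncexpr" where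
  "pi_expr Var_alpha = u_expr"
| "pi_expr Var_beta = nc_pow v_expr 2"
| "pi_expr Var_gamma = Mult (Mult v_expr u_expr) v_expr"

lemma represents_pi_expr: "represents (pi_expr w) (pi_fun w)"
proof -
  have u: "represents u_expr u_fun"
    unfolding u_fun_def x_fun_def y_fun_def
    by (intro represents_Smult represents_Add represents_Var)
  have v: "represents v_expr v_fun"
    unfolding v_fun_def x_fun_def y_fun_def
    by (intro represents_Smult represents_minus represents_Var)
  show ?thesis
    using u v by (cases w) (simp_all add: represents_nc_pow represents_Mult)
qed

text \<open>No inverse occurs in \<open>pi_expr\<close>, so it is defined at every tuple and
  \<open>nc_eval_subst\<close> applies there.\<close>

lemma nc_eval_pi_expr:
  assumes "mat_tuple k Z"
  shows "nc_eval k Z (pi_expr w) = Some (pi_mat (Z Var_x) (Z Var_y) w)"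
proof -
  have Z: "Z Var_x \<in> carrier_mat k k" "Z Var_y \<in> carrier_mat k k"
    using assms by (auto simp: mat_tuple_def)
  have v: "nc_eval k Z v_expr = Some ((1/2) \<cdot>\<^sub>m (Z Var_x - Z Var_y))"
    using Z by (auto intro!: eq_matI)
  have "nc_eval k Z (nc_pow v_expr 2) = Some (((1/2) \<cdot>\<^sub>m (Z Var_x - Z Var_y)) ^\<^sub>m 2)"
    by (rule nc_eval_nc_pow[OF v]) (use Z in auto)
  with v show ?thesis by (cases w) simp_all
qed

text \<open>Substitution might degenerate, so a point of definition is exhibited first. Equivalence
  with \<open>x^n + y^n\<close> then follows by comparing values.\<close>

lemma represents_P_comp: "represents (nc_subst pi_expr (P_expr n)) (p_fun n)"
proof -
  let ?e = "nc_subst pi_expr (P_expr n)"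
  let ?f = "Add (nc_pow (Var Var_x) n) (nc_pow (Var Var_y) n)"
  have f: "represents ?f (p_fun n)"
    unfolding p_fun_def x_fun_def y_fun_def
    by (intro represents_Add represents_nc_pow represents_Var)
  have ev: "nc_eval k Z ?e = nc_eval k (pi_mat (Z Var_x) (Z Var_y)) (P_expr n)"
    if "mat_tuple k Z" for k Z
    using nc_eval_pi_expr[OF that] by (rule nc_eval_subst)
  have "nondegenerate ?e"
  proof -
    \<comment> \<open>At size 1, \<open>x = 1\<close> and \<open>y = 0\<close> give the invertible
      difference 1.\<close>
    define Z :: "var_xy \<Rightarrow> complex mat"
      where "Z v = (case v of Var_x \<Rightarrow> 1\<^sub>m 1 | Var_y \<Rightarrow> 0\<^sub>m 1 1)" for v
    have Z: "mat_tuple 1 Z" by (auto simp: mat_tuple_def Z_def split: var_xy.split)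
    have "1\<^sub>m 1 - 0\<^sub>m 1 1 = (1\<^sub>m 1 :: complex mat)" by (rule eq_matI) auto
    hence "invertible_mat (Z Var_x - Z Var_y)"
      by (simp add: Z_def invertible_mat_def inverts_mat_def) (rule exI[of _ "1\<^sub>m 1"], simp)
    with Z have "nc_eval 1 Z ?e = Some (Z Var_x ^\<^sub>m n + Z Var_y ^\<^sub>m n)"
      unfolding ev[OF Z] by (intro P_expr_eval) (auto simp: mat_tuple_def)
    with Z show ?thesis unfolding nondegenerate_def by blast
  qed
  moreover have "nc_equiv ?e ?f"
  proof (rule nc_equivI)
    fix k and Z :: "var_xy \<Rightarrow> complex mat" and A B
    assume Z: "mat_tuple k Z" and A: "nc_eval k Z ?e = Some A" and B: "nc_eval k Z ?f = Some B"
    have c: "Z v \<in> carrier_mat k k" for v using Z by (simp add: mat_tuple_def)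
    \<comment> \<open>The conditional value lemma is applied because
      \<open>Z Var_x - Z Var_y\<close> may be singular at this point.\<close>
    have "A = Z Var_x ^\<^sub>m n + Z Var_y ^\<^sub>m n"
      using A PQ_expr_value[OF c c, of Var_x Var_y n] unfolding ev[OF Z] by blast
    moreover have "B = Z Var_x ^\<^sub>m n + Z Var_y ^\<^sub>m n"
      using B c by (simp add: nc_eval_nc_pow)
    ultimately show "A = B" by simp
  qed (use f \<open>nondegenerate ?e\<close> in \<open>auto simp: represents_def\<close>)
  ultimately show ?thesis using f by (simp add: represents_def abs_ncrat_eq)
qed

section \<open>The matrix recursion\<close>

lemma u_fun_v_fun: "u_fun + v_fun = x_fun" "u_fun - v_fun = y_fun"
proof -
  have "ncrat_scale (1/2) F + ncrat_scale (1/2) F = F" for F :: "var_xy ncrat"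
    using ncrat_scale_add_scalar[of "1/2" "1/2" F] by simp
  \<comment> \<open>Additivity is applied to \<open>(F - G) + G = F\<close>.\<close>
  moreover have "ncrat_scale c (F - G) = ncrat_scale c F - ncrat_scale c G"
    for c and F G :: "var_xy ncrat"
    using ncrat_scale_add[of c "F - G" G] by (simp add: algebra_simps)
  ultimately show "u_fun + v_fun = x_fun" "u_fun - v_fun = y_fun"
    by (simp_all add: u_fun_def v_fun_def ncrat_scale_add)
qed

text \<open>The leading factors of \<open>x * x^n\<close> and \<open>y * y^n\<close> are expanded as
  \<open>u + v\<close> and \<open>u - v\<close>, a pure ring identity.\<close>

lemma pq_fun_Suc:
  "p_fun (Suc n) = u_fun * p_fun n + v_fun * q_fun n"
  "q_fun (Suc n) = v_fun * p_fun n + u_fun * q_fun n"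
  by (simp_all add: p_fun_def q_fun_def u_fun_v_fun[symmetric] algebra_simps)

lemma uv_matrix_carrier: "uv_matrix \<in> carrier_mat 2 2"
  by (rule carrier_matI) (simp_all add: uv_matrix_def mat_of_rows_list_def)

text \<open>The entries do not commute; the matrix acts by left multiplication, the order used in
  \<open>pq_fun_Suc\<close>.\<close>

lemma uv_matrix_mult_vec:
  "uv_matrix *\<^sub>v vec_of_list [a, b] = vec_of_list [u_fun * a + v_fun * b, v_fun * a + u_fun * b]"
proof (rule eq_vecI)
  fix i assume "i < dim_vec (vec_of_list [u_fun * a + v_fun * b, v_fun * a + u_fun * b])"
  hence i: "i = 0 \<or> i = 1" by (auto simp: less_Suc_eq)
  have "(uv_matrix *\<^sub>v vec_of_list [a, b]) $ i = (\<Sum>j<2. uv_matrix $$ (i, j) * [a, b] ! j)"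
    using i uv_matrix_carrier
    by (auto simp: scalar_prod_def vec_of_list_index atLeast0LessThan eval_nat_numeral
        simp del: vec_of_list_Cons)
  also have "\<dots> = [u_fun * a + v_fun * b, v_fun * a + u_fun * b] ! i"
    using i by (auto simp: uv_matrix_def mat_of_rows_list_def eval_nat_numeral)
  finally show "(uv_matrix *\<^sub>v vec_of_list [a, b]) $ i =
      vec_of_list [u_fun * a + v_fun * b, v_fun * a + u_fun * b] $ i"
    unfolding vec_of_list_index .
qed (simp add: uv_matrix_def mat_of_rows_list_def)

lemma pq_fun_uv_matrix:
  "vec_of_list [p_fun n, q_fun n] = (uv_matrix ^\<^sub>m n) *\<^sub>v vec_of_list [2, 0]"
proof (induction n)
  case 0
  have d: "dim_vec (vec_of_list [2 :: var_xy ncrat, 0]) = 2" unfolding dim_vec_of_list by simp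
  have "(uv_matrix ^\<^sub>m 0) *\<^sub>v vec_of_list [2, 0] = vec_of_list [2, 0]"
    using one_mult_mat_vec[OF carrier_vecI[OF d]] uv_matrix_carrier by (simp del: vec_of_list_Cons)
  moreover have "vec_of_list [p_fun 0, q_fun 0] = vec_of_list [2, 0]"
    unfolding p_fun_def q_fun_def power_0 by (simp only: one_add_one diff_self)
  ultimately show ?case by (simp only:)
next
  case (Suc n)
  have "dim_vec (vec_of_list [2 :: var_xy ncrat, 0]) = 2" unfolding dim_vec_of_list by simp
  \<comment> \<open>One factor is split off on the left, so that the induction hypothesis applies to
    the remaining power.\<close>
  from assoc_mult_mat_vec[OF uv_matrix_carrier pow_carrier_mat[OF uv_matrix_carrier]
      carrier_vecI[OF this]]
  have "(uv_matrix ^\<^sub>m Suc n) *\<^sub>v vec_of_list [2, 0] =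
      uv_matrix *\<^sub>v ((uv_matrix ^\<^sub>m n) *\<^sub>v vec_of_list [2, 0])"
    unfolding pow_mat_Suc_left[OF uv_matrix_carrier] .
  also have "\<dots> = vec_of_list [p_fun (Suc n), q_fun (Suc n)]"
    unfolding Suc.IH[symmetric] uv_matrix_mult_vec pq_fun_Suc ..
  finally show ?case by (rule sym)
qed

theorem theorem11p10:
  shows "\<exists>P Q :: nat \<Rightarrow> var_abc ncrat.
    (\<forall>n>0. is_ncrat_comp (P n) pi_fun (p_fun n) \<and>
       (\<forall>k X Y. 0 < k \<longrightarrow> X \<in> carrier_mat k k \<longrightarrow> Y \<in> carrier_mat k k \<longrightarrow> invertible_mat (X - Y) \<longrightarrow>
          ncrat_value k (pi_mat X Y) (P n) (X ^\<^sub>m n + Y ^\<^sub>m n)) \<and>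
       (\<exists>f :: letter fpoly. P n = fpoly_subst letter_fun f)) \<and>
    (\<forall>n. vec_of_list [p_fun n, q_fun n] = (uv_matrix ^\<^sub>m n) *\<^sub>v vec_of_list [2, 0]) \<and>
    P 0 = 2 \<and> Q 0 = 0 \<and>
    (\<forall>n. P (Suc n) = alpha_fun * P n + Q n \<and>
         Q (Suc n) = beta_fun * P n + gamma_fun * beta_inv_fun * Q n)"
proof (rule exI[of _ P_fun], rule exI[of _ Q_fun], intro conjI allI impI)
  fix n
  \<comment> \<open>The representatives witnessing the composition are \<open>P_expr n\<close> and
    \<open>pi_expr\<close>.\<close>
  show "is_ncrat_comp (P_fun n) pi_fun (p_fun n)"
    unfolding is_ncrat_comp_def
    using represents_P_expr represents_pi_expr represents_P_comp by blast
  show "\<exists>f. P_fun n = fpoly_subst letter_fun f"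
    using PQ_fun_fpoly[of n] by blast
  fix k and X Y :: "complex mat"
  assume *: "0 < k" "X \<in> carrier_mat k k" "Y \<in> carrier_mat k k" "invertible_mat (X - Y)"
  hence "mat_tuple k (pi_mat X Y)" by (simp add: mat_tuple_def pi_mat_carrier)
  with P_expr_eval[OF *(2-4)] represents_P_expr
  show "ncrat_value k (pi_mat X Y) (P_fun n) (X ^\<^sub>m n + Y ^\<^sub>m n)"
    unfolding ncrat_value_def by blast
qed (rule pq_fun_uv_matrix PQ_fun_0 PQ_fun_Suc)+

end
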